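(* Let $n\in\mathbb{N}$ with $n>1$ and let $A\subseteq\mathbb{N}$ be multiplicatively piecewise syndetic. Then there exist $x,y\in A$ such that $x\,n^{y}\in A$.
   Context: $\mathbb{N}=\{1,2,3,\dots\}$. For $f\in\mathbb{N}$ and $B\subseteq\mathbb{N}$ write $f^{-1}B=\{y\in\mathbb{N}: fy\in B\}$. A set $T\subseteq\mathbb{N}$ is multiplicatively thick if for every finite $H\subseteq\mathbb{N}$ there is $x\in\mathbb{N}$ with $Hx=\{hx:h\in H\}\subseteq T$. A set $A\subseteq\mathbb{N}$ is multiplicatively piecewise syndetic if there is a finite set $F\subseteq\mathbb{N}$ such that $\bigcup_{f\in F}f^{-1}A$ is multiplicatively thick. *)

theory Defs
  imports Main
begin

text \<open>
  The natural numbers of the source start at 1. They are rendered as the subset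
  \<open>{0<..}\<close> of type \<^typ>\<open>nat\<close>, and every set and element is restricted to it explicitly.
\<close>

abbreviation pos_nat :: "nat set" where
  "pos_nat \<equiv> {0<..}"

definition dilate_inv :: "nat \<Rightarrow> nat set \<Rightarrow> nat set" where
  "dilate_inv f B = {y \<in> pos_nat. f * y \<in> B}"

definition mult_thick :: "nat set \<Rightarrow> bool" where
  "mult_thick T \<longleftrightarrow>
     T \<subseteq> pos_nat \<and>
     (\<forall>H. finite H \<and> H \<subseteq> pos_nat \<longrightarrow> (\<exists>x\<in>pos_nat. (\<lambda>h. h * x) ` H \<subseteq> T))"

definition mult_piecewise_syndetic :: "nat set \<Rightarrow> bool" where
  "mult_piecewise_syndetic A \<longleftrightarrow>
     A \<subseteq> pos_nat \<and>
     (\<exists>F. finite F \<and> F \<subseteq> pos_nat \<and> mult_thick (\<Union>f\<in>F. dilate_inv f A))"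

end

theory Submission
  imports Defs "HOL-Library.Ramsey"
begin

text \<open>
  Let \<open>F\<close> witness piecewise syndeticity and let \<open>r\<close> be its cardinality. Thickness gives, for
  arbitrarily large \<open>N\<close>, a number \<open>a\<close> such that every \<open>0 < d < N\<close> can be coloured by some \<open>f \<in> F\<close>
  with \<open>f d a \<in> A\<close>. Colouring the pair \<open>i < j\<close> by the colour of \<open>j - i\<close>, Ramsey's theorem yields a
  set \<open>S\<close> of \<open>r + 1\<close> numbers and a single \<open>f\<close> with \<open>f (j - i) a \<in> A\<close> for all \<open>i < j\<close> in \<open>S\<close>.
  Thickness for the powers \<open>n ^ (f a j)\<close>, \<open>j \<in> S\<close>, gives a number \<open>b\<close> and colours \<open>g \<in> F\<close> with
  \<open>g n ^ (f a j) b \<in> A\<close>; two elements \<open>i < j\<close> of \<open>S\<close> share the same \<open>g\<close>, and then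
  \<open>x = g n ^ (f a i) b\<close> and \<open>y = f (j - i) a\<close> are as required.
\<close>

text \<open>\<open>N\<close> depends only on \<open>card F\<close> and \<open>m\<close>: it must be
  fixed before \<open>c\<close>, because the colouring used later comes from thickness applied to
  \<open>{0<..<N}\<close>.\<close>

lemma ramsey_differences:
  fixes F :: "'a set" and m :: nat
  assumes "finite F"
  obtains N :: nat where
    "\<And>c. (\<And>d. 0 < d \<Longrightarrow> d < N \<Longrightarrow> c d \<in> F) \<Longrightarrow>
      \<exists>S f. S \<subseteq> {..<N} \<and> card S = m \<and> f \<in> F \<and> (\<forall>i\<in>S. \<forall>j\<in>S. i < j \<longrightarrow> c (j - i) = f)"
proof -
  let ?r = "card F"
  obtain N :: nat where N: "partn_lst {..<N} (replicate ?r m) 2"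
    using ramsey_full by (rule exE)
  obtain h where h: "bij_betw h F {..<?r}"
    using ex_bij_betw_finite_nat[OF assms] by (auto simp: lessThan_atLeast0)
  have "\<exists>S f. S \<subseteq> {..<N} \<and> card S = m \<and> f \<in> F \<and> (\<forall>i\<in>S. \<forall>j\<in>S. i < j \<longrightarrow> c (j - i) = f)"
    if c: "\<And>d. 0 < d \<Longrightarrow> d < N \<Longrightarrow> c d \<in> F" for c
  proof -
    \<comment> \<open>On a pair, \<open>Max e - Min e\<close> is the difference of its two elements;
      \<open>h\<close> renames the colours to numbers, as \<open>partn_lst\<close> expects.\<close>
    define k where "k e = h (c (Max e - Min e))" for e
    have "k e \<in> {..<?r}" if e: "e \<in> [{..<N}]\<^bsup>2\<^esup>" for e
    proof -
      obtain x y where "e = {x, y}" "x < N" "y < N" "x \<noteq> y"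
        using nsets2_E[OF e] by (metis lessThan_iff)
      then have "c (Max e - Min e) \<in> F"
        by (intro c) (auto simp: max_def min_def)
      then show ?thesis
        using h by (auto simp: k_def bij_betw_def)
    qed
    then have "k \<in> [{..<N}]\<^bsup>2\<^esup> \<rightarrow> {..<?r}"
      by blast
    then obtain t where t: "t < ?r" "monochromatic {..<N} (replicate ?r m ! t) 2 k t"
      using N by (metis partn_lst_def length_replicate)
    then obtain S where S: "S \<in> [{..<N}]\<^bsup>m\<^esup>" and mono: "k ` [S]\<^bsup>2\<^esup> \<subseteq> {t}"
      unfolding monochromatic_def nth_replicate[OF t(1)] by blast
    have SN: "S \<subseteq> {..<N}"
      using S by (simp add: nsets_def)
    obtain f where f: "f \<in> F" "h f = t"
      using bij_betw_imp_surj_on[OF h] t(1) by (metis imageE lessThan_iff)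
    have "c (j - i) = f" if ij: "i \<in> S" "j \<in> S" "i < j" for i j
    proof -
      have "{i, j} \<in> [S]\<^bsup>2\<^esup>"
        using ij by simp
      then have "k {i, j} = t"
        using mono by blast
      then have "h (c (j - i)) = h f"
        using ij f by (simp add: k_def max_def min_def)
      moreover have "c (j - i) \<in> F"
        using ij SN by (intro c) auto
      ultimately show ?thesis
        using h f by (auto simp: bij_betw_def inj_on_def)
    qed
    then show ?thesis
      using S f by (auto simp: nsets_def)
  qed
  then show ?thesis
    by (rule that)
qed

text \<open>Choosing one \<open>f\<close> for each \<open>h\<close> turns thickness into a colouring
  of \<open>H\<close> by \<open>F\<close>, ready for Ramsey and then for the pigeonhole
  principle.\<close>

lemma mult_thick_UN_dilate_invE:
  assumes "mult_thick (\<Union>f\<in>F. dilate_inv f A)" "finite H" "H \<subseteq> pos_nat"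
  obtains a c where "\<And>h. h \<in> H \<Longrightarrow> c h \<in> F" "\<And>h. h \<in> H \<Longrightarrow> c h * (h * a) \<in> A"
proof -
  obtain a where "(\<lambda>h. h * a) ` H \<subseteq> (\<Union>f\<in>F. dilate_inv f A)"
    using assms unfolding mult_thick_def by blast
  then have "\<forall>h\<in>H. \<exists>f\<in>F. f * (h * a) \<in> A"
    by (fastforce simp: dilate_inv_def)
  then show ?thesis
    using that by metis
qed

theorem theorem1p6:
  fixes n :: nat and A :: "nat set"
  assumes "n > 1"
    and "mult_piecewise_syndetic A"
  shows "\<exists>x\<in>A. \<exists>y\<in>A. x * n ^ y \<in> A"
proof -
  obtain F where F: "finite F" and thick: "mult_thick (\<Union>f\<in>F. dilate_inv f A)"
    using assms(2) unfolding mult_piecewise_syndetic_def by blast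
  obtain N :: nat where N: "\<And>c. (\<And>d. 0 < d \<Longrightarrow> d < N \<Longrightarrow> c d \<in> F) \<Longrightarrow>
      \<exists>S f. S \<subseteq> {..<N} \<and> card S = Suc (card F) \<and> f \<in> F \<and>
        (\<forall>i\<in>S. \<forall>j\<in>S. i < j \<longrightarrow> c (j - i) = f)"
    using ramsey_differences[OF F, of "Suc (card F)"] by blast
  obtain a c where c: "\<And>d. d \<in> {0<..<N} \<Longrightarrow> c d \<in> F"
    and cA: "\<And>d. d \<in> {0<..<N} \<Longrightarrow> c d * (d * a) \<in> A"
    by (rule mult_thick_UN_dilate_invE[OF thick, of "{0<..<N}"]) auto
  obtain S f where S: "S \<subseteq> {..<N}" "card S = Suc (card F)"
    and f: "\<And>i j. i \<in> S \<Longrightarrow> j \<in> S \<Longrightarrow> i < j \<Longrightarrow> c (j - i) = f"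
    using N[of c] c by auto
  have y: "f * ((j - i) * a) \<in> A" if "i \<in> S" "j \<in> S" "i < j" for i j
    using cA[of "j - i"] f[OF that] that S by auto
  \<comment> \<open>The factor \<open>f * a\<close> makes the exponents for \<open>i < j\<close>
    differ by exactly \<open>f * ((j - i) * a)\<close>, which \<open>y\<close> places in
    \<open>A\<close>.\<close>
  let ?p = "\<lambda>j. n ^ (f * a * j)"
  have fin: "finite S"
    using S(1) by (rule finite_subset) simp
  obtain b g where g: "\<And>h. h \<in> ?p ` S \<Longrightarrow> g h \<in> F"
    and gA: "\<And>h. h \<in> ?p ` S \<Longrightarrow> g h * (h * b) \<in> A"
    by (rule mult_thick_UN_dilate_invE[OF thick, of "?p ` S"]) (use assms(1) fin in auto)
  have "\<not> inj_on (\<lambda>j. g (?p j)) S"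
  proof
    assume "inj_on (\<lambda>j. g (?p j)) S"
    then have "card S \<le> card F"
      using g by (intro card_inj_on_le[OF _ _ F]) auto
    then show False
      using S by simp
  qed
  then obtain i j where ij: "i \<in> S" "j \<in> S" "i < j" and eq: "g (?p i) = g (?p j)"
    unfolding inj_on_def by (metis linorder_neqE_nat)
  have "?p j = ?p i * n ^ (f * ((j - i) * a))"
  proof -
    have "f * a * j = f * a * i + f * ((j - i) * a)"
      using ij by (simp add: diff_mult_distrib2 diff_mult_distrib mult_ac)
    then show ?thesis
      by (simp add: power_add)
  qed
  then have "g (?p i) * (?p i * b) * n ^ (f * ((j - i) * a)) = g (?p j) * (?p j * b)"
    using eq by (simp add: mult_ac)
  then have "g (?p i) * (?p i * b) * n ^ (f * ((j - i) * a)) \<in> A"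
    using gA[OF imageI[OF ij(2)]] by (simp only:)
  then show ?thesis
    using gA[OF imageI[OF ij(1)]] y[OF ij] by blast
qed

end
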